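(* Let $\mathcal C$ be a category, $M\colon\mathcal C\to\mathcal C$ a functor, and $\psi\colon M\to\mathrm{id}_{\mathcal C}$ a natural transformation such that $M\psi\colon M^2\to M$ is a natural isomorphism. Let $\mathcal C_m$ be the full subcategory of $\mathcal C$ formed by those objects $x$ for which $\psi_x\colon Mx\to x$ is an isomorphism. If $f\colon y\to x$ is a morphism in $\mathcal C$ with $y\in\mathcal C_m$, then there is a unique morphism $\widetilde f\colon y\to Mx$ in $\mathcal C$ such that $\psi_x\circ\widetilde f=f$.
   Context: The natural transformation $M\psi\colon M^2\to M$ has components $(M\psi)_x:=M(\psi_x)\colon M^2x\to Mx$ for each object $x$ of $\mathcal C$. *)

theory Defs
  imports Main
begin

text \<open>Categories are given by carriers of objects and arrows inside HOL types; all operations are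
  unconstrained off these carriers. \<open>Comp C g f\<close> is the composite ``\<open>g\<close> after \<open>f\<close>''.\<close>

record ('o, 'a) cat =
  Obj :: "'o set"
  Arr :: "'a set"
  Dom :: "'a \<Rightarrow> 'o"
  Cod :: "'a \<Rightarrow> 'o"
  Id :: "'o \<Rightarrow> 'a"
  Comp :: "'a \<Rightarrow> 'a \<Rightarrow> 'a"

definition hom :: "('o, 'a) cat \<Rightarrow> 'o \<Rightarrow> 'o \<Rightarrow> 'a set" where
  "hom C x y = {f \<in> Arr C. Dom C f = x \<and> Cod C f = y}"

locale category =
  fixes C :: "('o, 'a) cat"
  assumes Dom_Obj: "f \<in> Arr C \<Longrightarrow> Dom C f \<in> Obj C"
    and Cod_Obj: "f \<in> Arr C \<Longrightarrow> Cod C f \<in> Obj C"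
    and Id_hom: "x \<in> Obj C \<Longrightarrow> Id C x \<in> hom C x x"
    and Comp_hom: "f \<in> hom C x y \<Longrightarrow> g \<in> hom C y z \<Longrightarrow> Comp C g f \<in> hom C x z"
    and Comp_Id: "f \<in> hom C x y \<Longrightarrow> Comp C f (Id C x) = f"
    and Id_Comp: "f \<in> hom C x y \<Longrightarrow> Comp C (Id C y) f = f"
    and Comp_assoc: "f \<in> hom C w x \<Longrightarrow> g \<in> hom C x y \<Longrightarrow> h \<in> hom C y z \<Longrightarrow>
      Comp C h (Comp C g f) = Comp C (Comp C h g) f"

definition iso :: "('o, 'a) cat \<Rightarrow> 'a \<Rightarrow> bool" where
  "iso C f \<longleftrightarrow> f \<in> Arr C \<and>
    (\<exists>g \<in> hom C (Cod C f) (Dom C f).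
      Comp C g f = Id C (Dom C f) \<and> Comp C f g = Id C (Cod C f))"

definition full_subcategory :: "('o, 'a) cat \<Rightarrow> 'o set \<Rightarrow> ('o, 'a) cat" where
  "full_subcategory C S =
    C\<lparr>Obj := Obj C \<inter> S, Arr := {f \<in> Arr C. Dom C f \<in> S \<and> Cod C f \<in> S}\<rparr>"

record ('o, 'a, 'p, 'b) func =
  on_obj :: "'o \<Rightarrow> 'p"
  on_arr :: "'a \<Rightarrow> 'b"

locale cat_functor = source: category C + target: category D
  for C :: "('o, 'a) cat" and D :: "('p, 'b) cat" +
  fixes F :: "('o, 'a, 'p, 'b) func"
  assumes on_obj_Obj: "x \<in> Obj C \<Longrightarrow> on_obj F x \<in> Obj D"
    and on_arr_hom: "f \<in> hom C x y \<Longrightarrow> on_arr F f \<in> hom D (on_obj F x) (on_obj F y)"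
    and on_arr_Id: "x \<in> Obj C \<Longrightarrow> on_arr F (Id C x) = Id D (on_obj F x)"
    and on_arr_Comp: "f \<in> hom C x y \<Longrightarrow> g \<in> hom C y z \<Longrightarrow>
      on_arr F (Comp C g f) = Comp D (on_arr F g) (on_arr F f)"

definition id_func :: "('o, 'a, 'o, 'a) func" where
  "id_func = \<lparr>on_obj = (\<lambda>x. x), on_arr = (\<lambda>f. f)\<rparr>"

definition comp_func ::
  "('p, 'b, 'q, 'c) func \<Rightarrow> ('o, 'a, 'p, 'b) func \<Rightarrow> ('o, 'a, 'q, 'c) func" where
  "comp_func G F =
    \<lparr>on_obj = (\<lambda>x. on_obj G (on_obj F x)), on_arr = (\<lambda>f. on_arr G (on_arr F f))\<rparr>"

locale nat_trans = source: cat_functor C D F + target: cat_functor C D G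
  for C :: "('o, 'a) cat" and D :: "('p, 'b) cat"
    and F :: "('o, 'a, 'p, 'b) func" and G :: "('o, 'a, 'p, 'b) func" +
  fixes \<eta> :: "'o \<Rightarrow> 'b"
  assumes component_hom: "x \<in> Obj C \<Longrightarrow> \<eta> x \<in> hom D (on_obj F x) (on_obj G x)"
    and naturality: "f \<in> hom C x y \<Longrightarrow>
      Comp D (\<eta> y) (on_arr F f) = Comp D (on_arr G f) (\<eta> x)"

locale nat_iso = nat_trans C D F G \<eta>
  for C :: "('o, 'a) cat" and D :: "('p, 'b) cat"
    and F :: "('o, 'a, 'p, 'b) func" and G :: "('o, 'a, 'p, 'b) func" and \<eta> :: "'o \<Rightarrow> 'b" +
  assumes component_iso: "x \<in> Obj C \<Longrightarrow> iso D (\<eta> x)"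

definition whisker :: "('p, 'b, 'q, 'c) func \<Rightarrow> ('o \<Rightarrow> 'b) \<Rightarrow> 'o \<Rightarrow> 'c" where
  "whisker H \<eta> = (\<lambda>x. on_arr H (\<eta> x))"

definition iso_subcategory :: "('o, 'a) cat \<Rightarrow> ('o \<Rightarrow> 'a) \<Rightarrow> ('o, 'a) cat" where
  "iso_subcategory C \<psi> = full_subcategory C {x \<in> Obj C. iso C (\<psi> x)}"

lemma category_full_subcategory:
  assumes "category C"
  shows "category (full_subcategory C S)"
proof -
  interpret category C by fact
  have hom_sub: "f \<in> hom (full_subcategory C S) x y \<longleftrightarrow> f \<in> hom C x y \<and> x \<in> S \<and> y \<in> S" for f x y
    by (auto simp: hom_def full_subcategory_def)
  have sel: "Obj (full_subcategory C S) = Obj C \<inter> S"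
      "Dom (full_subcategory C S) = Dom C" "Cod (full_subcategory C S) = Cod C"
      "Id (full_subcategory C S) = Id C" "Comp (full_subcategory C S) = Comp C"
      "Arr (full_subcategory C S) = {f \<in> Arr C. Dom C f \<in> S \<and> Cod C f \<in> S}"
    by (simp_all add: full_subcategory_def)
  show ?thesis
    by unfold_locales
      (auto simp: hom_sub sel Dom_Obj Cod_Obj Id_hom Comp_Id Id_Comp
        intro: Comp_hom Comp_assoc)
qed

lemma cat_functor_id_func:
  assumes "category C"
  shows "cat_functor C C id_func"
proof -
  interpret category C by fact
  show ?thesis by unfold_locales (auto simp: id_func_def)
qed

lemma cat_functor_comp_func:
  assumes "cat_functor C D F" and "cat_functor D E G"
  shows "cat_functor C E (comp_func G F)"
proof -
  interpret F: cat_functor C D F by fact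
  interpret G: cat_functor D E G by fact
  show ?thesis
    by unfold_locales
      (auto simp: comp_func_def F.on_obj_Obj G.on_obj_Obj F.on_arr_Id G.on_arr_Id
        F.on_arr_Comp G.on_arr_Comp[OF F.on_arr_hom F.on_arr_hom]
        intro: F.on_arr_hom G.on_arr_hom)
qed

end

theory Submission
  imports Defs
begin

text \<open>
  A lift of \<open>f: y \<rightarrow> x\<close> through \<open>\<psi> x\<close> comes from naturality. The square of \<open>\<psi>\<close> at \<open>f\<close> reads
  \<open>\<psi> x \<circ> M f = f \<circ> \<psi> y\<close>, and \<open>\<psi> y\<close> is invertible, so \<open>M f \<circ> (\<psi> y)\<inverse>\<close> is a lift.

  Uniqueness is where invertibility of \<open>M \<psi>\<close> enters. Although \<open>\<psi> x\<close> itself need not be monic,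
  \<open>M (\<psi> x)\<close> is, so two arrows \<open>g, h: y \<rightarrow> M x\<close> equalized by \<open>\<psi> x\<close> have \<open>M g = M h\<close>.
  Naturality of \<open>\<psi>\<close> at \<open>g\<close> and at \<open>h\<close> then gives
  \<open>g \<circ> \<psi> y = \<psi> (M x) \<circ> M g = \<psi> (M x) \<circ> M h = h \<circ> \<psi> y\<close>, and \<open>\<psi> y\<close> is epic.
\<close>

context category
begin

lemma iso_obtain_inverse:
  assumes "iso C f" "f \<in> hom C x y"
  obtains g where "g \<in> hom C y x" "Comp C g f = Id C x" "Comp C f g = Id C y"
  using assms unfolding iso_def hom_def by auto

lemma iso_monic:
  assumes "iso C f" and f: "f \<in> hom C x y" and g: "g \<in> hom C w x" and h: "h \<in> hom C w x"
    and eq: "Comp C f g = Comp C f h"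
  shows "g = h"
proof -
  obtain k where k: "k \<in> hom C y x" "Comp C k f = Id C x"
    using \<open>iso C f\<close> f by (rule iso_obtain_inverse)
  have "g = Comp C k (Comp C f g)"
    using Comp_assoc[OF g f k(1)] k(2) Id_Comp[OF g] by simp
  also have "\<dots> = h"
    unfolding eq using Comp_assoc[OF h f k(1)] k(2) Id_Comp[OF h] by simp
  finally show ?thesis .
qed

lemma iso_epic:
  assumes "iso C f" and f: "f \<in> hom C x y" and g: "g \<in> hom C y z" and h: "h \<in> hom C y z"
    and eq: "Comp C g f = Comp C h f"
  shows "g = h"
proof -
  obtain k where k: "k \<in> hom C y x" "Comp C f k = Id C y"
    using \<open>iso C f\<close> f by (rule iso_obtain_inverse)
  have "g = Comp C (Comp C g f) k"
    using Comp_assoc[OF k(1) f g] k(2) Comp_Id[OF g] by simp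
  also have "\<dots> = h"
    unfolding eq using Comp_assoc[OF k(1) f h] k(2) Comp_Id[OF h] by simp
  finally show ?thesis .
qed

end

theorem proposition4p1:
  fixes C :: "('o, 'a) cat"
    and M :: "('o, 'a, 'o, 'a) func"
    and \<psi> :: "'o \<Rightarrow> 'a"
    and x y :: 'o
    and f :: 'a
  assumes "category C"
    and "cat_functor C C M"
    and "nat_trans C C M id_func \<psi>"
    and "nat_iso C C (comp_func M M) M (whisker M \<psi>)"
    and "x \<in> Obj C"
    and "y \<in> Obj (iso_subcategory C \<psi>)"
    and "f \<in> hom C y x"
  shows "\<exists>!f'. f' \<in> hom C y (on_obj M x) \<and> Comp C (\<psi> x) f' = f"
proof -
  interpret category C by fact
  interpret M: cat_functor C C M by fact
  interpret psi: nat_trans C C M id_func \<psi> by fact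
  interpret Mpsi: nat_iso C C "comp_func M M" M "whisker M \<psi>" by fact
  let ?M = "on_obj M" and ?Ma = "on_arr M"
  have y: "y \<in> Obj C" and iso_y: "iso C (\<psi> y)"
    using assms(6) by (simp_all add: iso_subcategory_def full_subcategory_def)
  have psi_hom: "\<psi> z \<in> hom C (?M z) z" if "z \<in> Obj C" for z
    using psi.component_hom[OF that] by (simp add: id_func_def)
  have psi_nat: "Comp C (\<psi> w) (?Ma g) = Comp C g (\<psi> z)" if "g \<in> hom C z w" for g z w
    using psi.naturality[OF that] by (simp add: id_func_def)
  have iso_Mpsi: "iso C (?Ma (\<psi> x))"
    using Mpsi.component_iso[OF assms(5)] by (simp add: whisker_def)
  note psi_x = psi_hom[OF assms(5)] and psi_y = psi_hom[OF y] and f = assms(7)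
  show ?thesis
  proof (rule ex_ex1I)
    obtain k where k: "k \<in> hom C y (?M y)" "Comp C (\<psi> y) k = Id C y"
      using iso_y psi_y by (rule iso_obtain_inverse)
    have Mf: "?Ma f \<in> hom C (?M y) (?M x)"
      using f by (rule M.on_arr_hom)
    have "Comp C (\<psi> x) (Comp C (?Ma f) k) = Comp C (Comp C f (\<psi> y)) k"
      using Comp_assoc[OF k(1) Mf psi_x] psi_nat[OF f] by simp
    also have "\<dots> = f"
      using Comp_assoc[OF k(1) psi_y f] k(2) Comp_Id[OF f] by simp
    finally show "\<exists>f'. f' \<in> hom C y (?M x) \<and> Comp C (\<psi> x) f' = f"
      using Comp_hom[OF k(1) Mf] by blast
  next
    fix g h
    assume "g \<in> hom C y (?M x) \<and> Comp C (\<psi> x) g = f"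
      and "h \<in> hom C y (?M x) \<and> Comp C (\<psi> x) h = f"
    then have g: "g \<in> hom C y (?M x)" and h: "h \<in> hom C y (?M x)"
      and eq: "Comp C (\<psi> x) g = Comp C (\<psi> x) h"
      by simp_all
    have "Comp C (?Ma (\<psi> x)) (?Ma g) = Comp C (?Ma (\<psi> x)) (?Ma h)"
      using M.on_arr_Comp[OF g psi_x] M.on_arr_Comp[OF h psi_x] eq by simp
    then have "?Ma g = ?Ma h"
      by (rule iso_monic[OF iso_Mpsi M.on_arr_hom[OF psi_x] M.on_arr_hom[OF g] M.on_arr_hom[OF h]])
    then have "Comp C g (\<psi> y) = Comp C h (\<psi> y)"
      using psi_nat[OF g] psi_nat[OF h] by simp
    then show "g = h"
      by (rule iso_epic[OF iso_y psi_y g h])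
  qed
qed

end
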